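(* For every positive integer $n$, the polynomials $\mathsf{ADerExc}_n(t)$, $\mathsf{ADerExc}_n^{+}(t)$ and $\mathsf{ADerExc}_n^{-}(t)$ are gamma positive with center of symmetry $n/2$.
   Context: $\mathfrak{S}_n$ is the symmetric group on $[n]$, $\mathcal{A}_n$ its even permutations, $\mathfrak{SD}_n=\{\pi\in\mathfrak{S}_n:\pi_i\ne i\ \forall i\}$ the derangements, $\mathfrak{SD}_n^{+}=\mathfrak{SD}_n\cap\mathcal{A}_n$, $\mathfrak{SD}_n^{-}=\mathfrak{SD}_n\setminus\mathcal{A}_n$. $\mathsf{exc}(\pi)=|\{i:\pi_i>i\}|$. $\mathsf{ADerExc}_n(t)=\sum_{\pi\in\mathfrak{SD}_n}t^{\mathsf{exc}(\pi)}$ and $\mathsf{ADerExc}_n^{\pm}(t)=\sum_{\pi\in\mathfrak{SD}_n^{\pm}}t^{\mathsf{exc}(\pi)}$. A polynomial $f(t)$ is gamma positive with center of symmetry $c$ ($2c\in\mathbb{Z}$) if $f(t)=\sum_{j}\gamma_jt^j(1+t)^{2c-2j}$, summing over integers $j$ with $0\le j\le c$, with all $\gamma_j\ge0$. *)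

theory Defs
  imports Complex_Main
    "HOL-Combinatorics.Permutations"
    "HOL-Computational_Algebra.Polynomial"
begin

definition sym_perms :: "nat \<Rightarrow> (nat \<Rightarrow> nat) set" where
  "sym_perms n = {p. p permutes {1..n}}"

definition alt_perms :: "nat \<Rightarrow> (nat \<Rightarrow> nat) set" where
  "alt_perms n = {p \<in> sym_perms n. evenperm p}"

definition derangements :: "nat \<Rightarrow> (nat \<Rightarrow> nat) set" where
  "derangements n = {p \<in> sym_perms n. \<forall>i\<in>{1..n}. p i \<noteq> i}"

definition even_derangements :: "nat \<Rightarrow> (nat \<Rightarrow> nat) set" where
  "even_derangements n = derangements n \<inter> alt_perms n"

definition odd_derangements :: "nat \<Rightarrow> (nat \<Rightarrow> nat) set" where
  "odd_derangements n = derangements n - alt_perms n"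

definition exc :: "nat \<Rightarrow> (nat \<Rightarrow> nat) \<Rightarrow> nat" where
  "exc n p = card {i \<in> {1..n}. p i > i}"

definition ADerExc :: "nat \<Rightarrow> real poly" where
  "ADerExc n = (\<Sum>p\<in>derangements n. monom 1 (exc n p))"

definition ADerExc_plus :: "nat \<Rightarrow> real poly" where
  "ADerExc_plus n = (\<Sum>p\<in>even_derangements n. monom 1 (exc n p))"

definition ADerExc_minus :: "nat \<Rightarrow> real poly" where
  "ADerExc_minus n = (\<Sum>p\<in>odd_derangements n. monom 1 (exc n p))"

text \<open>The exponent \<open>2 * c - 2 * j\<close> is a nonnegative integer for every \<open>j\<close> in the range of
  summation, because \<open>2 * c\<close> is required to be an integer and \<open>j \<le> c\<close>; hence neither the floor
  nor the conversion to \<^typ>\<open>nat\<close> changes its value. In particular the zero polynomial is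
  gamma positive with every centre of symmetry (take all coefficients zero).\<close>

definition gamma_positive :: "real poly \<Rightarrow> real \<Rightarrow> bool" where
  "gamma_positive f c \<longleftrightarrow> 2 * c \<in> \<int> \<and>
     (\<exists>\<gamma> :: nat \<Rightarrow> real. (\<forall>j. real j \<le> c \<longrightarrow> \<gamma> j \<ge> 0) \<and>
        f = (\<Sum>j | real j \<le> c. smult (\<gamma> j) ([:0, 1:] ^ j * [:1, 1:] ^ nat \<lfloor>2 * c - 2 * real j\<rfloor>)))"

end

theory Submission
  imports Defs
begin

text \<open>Removing the largest letter \<open>a\<close> from a derangement of a set with \<open>n + 1\<close> elements leaves
  either a derangement of the other \<open>n\<close> letters or, if \<open>a\<close> lies in a 2-cycle, one of \<open>n - 1\<close>
  letters; both operations change the parity. Reinserting \<open>a\<close> into an arc \<open>i \<rightarrow> p i\<close> creates a new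
  excedance exactly when that arc is not one. So the generating polynomial of one parity on
  \<open>n + 1\<close> letters is \<open>n t f + t (1 - t) f'\<close>, with \<open>f\<close> that of the opposite parity on \<open>n\<close> letters,
  plus \<open>t\<close> times polynomials of the opposite parity on \<open>n - 1\<close> letters. Both operators preserve
  gamma positivity and move the center to \<open>(n + 1) / 2\<close>, and the claim follows by induction. Working with
  arbitrary finite sets of letters avoids any relabelling.\<close>

section \<open>Gamma positive polynomials as a convex cone\<close>

text \<open>Generating the cone inductively, instead of carrying a coefficient sequence, reduces
  closure under a linear operator to the image of a single basis polynomial. The integer parameter
  is twice the center of symmetry.\<close>

inductive gamma_cone :: "nat \<Rightarrow> real poly \<Rightarrow> bool" for n where
  zero: "gamma_cone n 0"
| add_basis: "gamma_cone n f \<Longrightarrow> c \<ge> 0 \<Longrightarrow> 2 * j \<le> n \<Longrightarrow>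
    gamma_cone n (f + smult c ([:0, 1:] ^ j * [:1, 1:] ^ (n - 2 * j)))"

lemma gamma_cone_basis:
  assumes "c \<ge> 0" "2 * j \<le> n"
  shows "gamma_cone n (smult c ([:0, 1:] ^ j * [:1, 1:] ^ (n - 2 * j)))"
  using add_basis[OF zero assms] by simp

lemma gamma_cone_add:
  assumes "gamma_cone n f" "gamma_cone n g"
  shows "gamma_cone n (f + g)"
  using assms(2)
proof induction
  case zero
  then show ?case using assms(1) by simp
next
  case (add_basis g c j)
  then show ?case using gamma_cone.add_basis[of n "f + g" c j] by (simp add: add.assoc)
qed

lemma gamma_cone_sum:
  assumes "\<And>x. x \<in> A \<Longrightarrow> gamma_cone n (f x)"
  shows "gamma_cone n (\<Sum>x\<in>A. f x)"
  using assms by (induction A rule: infinite_finite_induct) (auto intro: zero gamma_cone_add)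

text \<open>Each generation step adds its \<open>c\<close> to the coefficient with index
  \<open>j\<close>, so the coefficients collect into one nonnegative sequence. The rest translates
  the real index bound and the floor into natural numbers.\<close>

lemma gamma_cone_imp_gamma_positive:
  assumes "gamma_cone n f"
  shows "gamma_positive f (real n / 2)"
proof -
  have range: "{j. real j \<le> real n / 2} = {j. 2 * j \<le> n}"
    by auto
  have fin: "finite {j. 2 * j \<le> n}"
    by (rule finite_subset[of _ "{..n}"]) auto
  have floor: "nat \<lfloor>2 * (real n / 2) - 2 * real j\<rfloor> = n - 2 * j" if "2 * j \<le> n" for j
  proof -
    have "2 * (real n / 2) - 2 * real j = of_int (int (n - 2 * j))"
      using that by (simp add: of_nat_diff)
    then show ?thesis by (metis floor_of_int nat_int)
  qed
  have "\<exists>\<gamma> :: nat \<Rightarrow> real. (\<forall>j. \<gamma> j \<ge> 0) \<and>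
      f = (\<Sum>j | 2 * j \<le> n. smult (\<gamma> j) ([:0, 1:] ^ j * [:1, 1:] ^ (n - 2 * j)))"
    using assms
  proof induction
    case zero
    show ?case by (rule exI[of _ "\<lambda>_. 0"]) simp
  next
    case (add_basis f c j)
    let ?b = "\<lambda>j. [:0, 1:] ^ j * [:1, 1:] ^ (n - 2 * j) :: real poly"
    obtain \<gamma> :: "nat \<Rightarrow> real" where \<gamma>: "\<forall>j. \<gamma> j \<ge> 0" "f = (\<Sum>j | 2 * j \<le> n. smult (\<gamma> j) (?b j))"
      using add_basis.IH by blast
    let ?\<delta> = "\<lambda>i. \<gamma> i + (if i = j then c else 0)"
    have "(\<Sum>i | 2 * i \<le> n. smult (?\<delta> i) (?b i))
        = (\<Sum>i | 2 * i \<le> n. smult (\<gamma> i) (?b i) + (if i = j then smult c (?b j) else 0))"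
      by (intro sum.cong) (auto simp: smult_add_left)
    also have "\<dots> = f + smult c (?b j)"
      using add_basis.hyps fin by (simp add: sum.distrib \<gamma>(2))
    finally show ?case
      using \<gamma>(1) add_basis.hyps by (intro exI[of _ ?\<delta>]) auto
  qed
  then obtain \<gamma> :: "nat \<Rightarrow> real" where \<gamma>: "\<forall>j. \<gamma> j \<ge> 0"
      "f = (\<Sum>j | 2 * j \<le> n. smult (\<gamma> j) ([:0, 1:] ^ j * [:1, 1:] ^ (n - 2 * j)))"
    by blast
  have "f = (\<Sum>j | real j \<le> real n / 2.
      smult (\<gamma> j) ([:0, 1:] ^ j * [:1, 1:] ^ nat \<lfloor>2 * (real n / 2) - 2 * real j\<rfloor>))"
    unfolding range \<gamma>(2) by (intro sum.cong refl) (simp only: floor mem_Collect_eq)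
  then show ?thesis
    unfolding gamma_positive_def using \<gamma>(1) by (auto intro!: exI[of _ \<gamma>])
qed

text \<open>The index \<open>j\<close> rises by one while the power of 1 + t stays, because n + 2 -
  2(j + 1) = n - 2j.\<close>

lemma gamma_cone_times_X:
  assumes "gamma_cone n f"
  shows "gamma_cone (n + 2) ([:0, 1:] * f)"
  using assms
proof induction
  case zero
  show ?case using gamma_cone.zero by simp
next
  case (add_basis f c j)
  have "gamma_cone (n + 2)
      ([:0, 1:] * f + smult c ([:0, 1:] ^ Suc j * [:1, 1:] ^ (n + 2 - 2 * Suc j)))"
    using add_basis by (intro gamma_cone.add_basis) auto
  then show ?case
    by (simp only: distrib_left mult_smult_right power_Suc mult.assoc) simp
qed

section \<open>The insertion operator\<close>

text \<open>This is the operator of the Eulerian recurrence without the summand \<open>f\<close>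
  that would count a new fixed point.\<close>

definition insertion_op :: "nat \<Rightarrow> real poly \<Rightarrow> real poly" where
  "insertion_op n f = smult (real n) ([:0, 1:] * f) + [:0, 1:] * [:1, -1:] * pderiv f"

lemma insertion_op_0: "insertion_op n 0 = 0"
  by (simp add: insertion_op_def)

lemma insertion_op_add: "insertion_op n (f + g) = insertion_op n f + insertion_op n g"
  by (simp only: insertion_op_def pderiv_add distrib_left smult_add_right add_ac)

lemma insertion_op_smult: "insertion_op n (smult c f) = smult c (insertion_op n f)"
  by (simp only: insertion_op_def pderiv_smult mult_smult_right smult_add_right smult_smult
      mult.commute[of "real n"])

lemma insertion_op_sum: "insertion_op n (\<Sum>x\<in>A. f x) = (\<Sum>x\<in>A. insertion_op n (f x))"
  by (induction A rule: infinite_finite_induct) (auto simp: insertion_op_0 insertion_op_add)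

lemma poly_insertion_op:
  "poly (insertion_op n f) x = real n * x * poly f x + x * (1 - x) * poly (pderiv f) x"
  by (simp add: insertion_op_def algebra_simps)

text \<open>The logarithmic derivative j/x + m/(1 + x), cleared of denominators so that no exponent
  j - 1 or m - 1 occurs.\<close>

lemma poly_basis_deriv:
  "x * (1 + x) * poly (pderiv ([:0, 1:] ^ j * [:1, 1:] ^ m)) x
    = (real j * (1 + x) + real m * x) * (x ^ j * (1 + x) ^ m)"
proof -
  have 1: "x * poly (pderiv ([:0, 1:] ^ j)) x = real j * x ^ j"
  proof (cases j)
    case (Suc k)
    show ?thesis unfolding Suc pderiv_power_Suc by (simp add: pderiv_pCons del: of_nat_Suc)
  qed simp
  have 2: "(1 + x) * poly (pderiv ([:1, 1:] ^ m)) x = real m * (1 + x) ^ m"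
  proof (cases m)
    case (Suc k)
    show ?thesis
      unfolding Suc pderiv_power_Suc by (simp add: pderiv_pCons algebra_simps del: of_nat_Suc)
  qed simp
  have "x * (1 + x) * poly (pderiv ([:0, 1:] ^ j * [:1, 1:] ^ m)) x
      = x * x ^ j * ((1 + x) * poly (pderiv ([:1, 1:] ^ m)) x)
        + (1 + x) * (1 + x) ^ m * (x * poly (pderiv ([:0, 1:] ^ j)) x)"
    by (simp add: pderiv_mult algebra_simps)
  then show ?thesis unfolding 1 2 by (simp add: algebra_simps)
qed

text \<open>After multiplication by 1 + x, everything rests on n x (1 + x) + (1 - x)(j (1 + x) + m
  x) = j (1 + x)^2 + 2 m x for n = 2j + m.\<close>

lemma insertion_op_basis:
  assumes n: "n = 2 * j + m"
  shows "insertion_op n ([:0, 1:] ^ j * [:1, 1:] ^ m)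
    = smult (real j) ([:0, 1:] ^ j * [:1, 1:] ^ (m + 1))
      + smult (2 * real m) ([:0, 1:] ^ (j + 1) * [:1, 1:] ^ (m - 1))" (is "?l = ?r")
proof -
  \<comment> \<open>For \<open>m = 0\<close> the truncated exponent \<open>m - 1\<close> is
    harmless, since the factor \<open>real m\<close> vanishes.\<close>
  have shift: "real m * ((1 + x) * (1 + x) ^ (m - 1)) = real m * (1 + x) ^ m" for x :: real
    by (cases m) auto
  \<comment> \<open>The extra factor 1 + t makes \<open>poly_basis_deriv\<close> applicable; it is
    cancelled at the end.\<close>
  have "poly ([:1, 1:] * ?l) x = poly ([:1, 1:] * ?r) x" for x
  proof -
    let ?B = "[:0, 1:] ^ j * [:1, 1:] ^ m :: real poly" and ?M = "x ^ j * (1 + x) ^ m"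
    have "poly ([:1, 1:] * ?l) x
        = real n * x * (1 + x) * ?M + (1 - x) * (x * (1 + x) * poly (pderiv ?B) x)"
      by (simp add: poly_insertion_op algebra_simps)
    also have "\<dots> = real j * (1 + x) ^ 2 * ?M + 2 * x * (x ^ j * (real m * (1 + x) ^ m))"
      unfolding poly_basis_deriv n by (simp add: algebra_simps power2_eq_square)
    also have "\<dots> = poly ([:1, 1:] * ?r) x"
      unfolding shift[symmetric] by (simp add: algebra_simps power2_eq_square)
    finally show ?thesis .
  qed
  then have "[:1, 1:] * ?l = [:1, 1:] * ?r"
    by (simp only: poly_eq_poly_eq_iff[symmetric] fun_eq_iff) simp
  then show ?thesis
    by (rule mult_left_cancel[THEN iffD1, rotated]) simp
qed

text \<open>Both terms in the image of a basis polynomial have nonnegative coefficients and the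
  right center: 2j + (m + 1) = 2(j + 1) + (m - 1) = n + 1.\<close>

lemma gamma_cone_insertion_op:
  assumes "gamma_cone n f"
  shows "gamma_cone (n + 1) (insertion_op n f)"
  using assms
proof induction
  case zero
  show ?case using gamma_cone.zero by (simp add: insertion_op_0)
next
  case (add_basis f c j)
  define m where "m = n - 2 * j"
  have n: "n = 2 * j + m" using add_basis.hyps by (simp add: m_def)
  have "gamma_cone (n + 1) (smult (c * real j) ([:0, 1:] ^ j * [:1, 1:] ^ (m + 1)))"
    using gamma_cone_basis[of "c * real j" j "n + 1"] add_basis.hyps n by simp
  moreover have "gamma_cone (n + 1)
      (smult (c * (2 * real m)) ([:0, 1:] ^ (j + 1) * [:1, 1:] ^ (m - 1)))"
  proof (cases m)
    \<comment> \<open>Here n = 2j, so index j + 1 would be out of range, but its coefficient is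
      zero.\<close>
    case 0
    then show ?thesis by (simp add: gamma_cone.zero)
  next
    case (Suc k)
    then show ?thesis
      using gamma_cone_basis[of "c * (2 * real m)" "j + 1" "n + 1"] add_basis.hyps n
      by simp
  qed
  ultimately have "gamma_cone (n + 1) (smult c (insertion_op n ([:0, 1:] ^ j * [:1, 1:] ^ m)))"
    unfolding insertion_op_basis[OF n] smult_add_right smult_smult by (rule gamma_cone_add)
  then show ?case
    unfolding insertion_op_add insertion_op_smult m_def[symmetric]
    using add_basis.IH by (intro gamma_cone_add)
qed

text \<open>With k excedances among n arcs, inserting into one of these k arcs keeps the count, and
  inserting into one of the other n - k raises it by one.\<close>

lemma insertion_op_monom:
  assumes "k \<le> n"
  shows "insertion_op n (monom 1 k)
    = smult (real k) (monom 1 k) + smult (real (n - k)) (monom 1 (k + 1))"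
proof (rule poly_eq_poly_eq_iff[THEN iffD1], rule ext)
  fix x :: real
  show "poly (insertion_op n (monom 1 k)) x
      = poly (smult (real k) (monom 1 k) + smult (real (n - k)) (monom 1 (k + 1))) x"
    using assms
    by (cases k)
       (simp_all add: poly_insertion_op pderiv_monom poly_monom of_nat_diff algebra_simps)
qed

section \<open>Derangements of a finite set and insertion of a largest letter\<close>

text \<open>The parity is a Boolean parameter, so that one recursion, flipping \<open>e\<close>,
  serves both signs.\<close>

definition deranged :: "bool \<Rightarrow> nat set \<Rightarrow> (nat \<Rightarrow> nat) set" where
  "deranged e S = {p. p permutes S \<and> (\<forall>i\<in>S. p i \<noteq> i) \<and> evenperm p = e}"

definition exc_set :: "nat set \<Rightarrow> (nat \<Rightarrow> nat) \<Rightarrow> nat set" where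
  "exc_set S p = {i \<in> S. i < p i}"

definition exc_poly :: "bool \<Rightarrow> nat set \<Rightarrow> real poly" where
  "exc_poly e S = (\<Sum>p\<in>deranged e S. monom 1 (card (exc_set S p)))"

lemma finite_deranged: "finite S \<Longrightarrow> finite (deranged e S)"
  by (rule finite_subset[OF _ finite_permutations[of S]]) (auto simp: deranged_def)

lemma evenperm_comp_transpose:
  assumes "p permutes S" "finite S" "a \<noteq> b"
  shows "evenperm (p \<circ> transpose a b) \<longleftrightarrow> \<not> evenperm p"
proof -
  have "permutation p"
    using assms by (auto simp: permutation_permutes)
  then show ?thesis
    using assms by (simp add: evenperm_comp evenperm_swap permutation_swap_id)
qed

text \<open>Composing with \<open>transpose a i\<close> replaces the arc from i to p i by arcs from
  i to a and from a to p i; if p fixes i, it creates the 2-cycle of a and i. Conversely, i is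
  recovered as the preimage of a.\<close>

lemma insertion_bij:
  assumes S: "finite S" "a \<notin> S"
  shows "bij_betw (\<lambda>(i, p). p \<circ> transpose a i)
    (SIGMA i:S. deranged (\<not> e) S \<union> deranged (\<not> e) (S - {i})) (deranged e (insert a S))"
proof (rule bij_betw_byWitness[where f' = "\<lambda>q. (inv q a, q \<circ> transpose a (inv q a))"])
  show "\<forall>x\<in>SIGMA i:S. deranged (\<not> e) S \<union> deranged (\<not> e) (S - {i}).
      (\<lambda>q. (inv q a, q \<circ> transpose a (inv q a))) ((\<lambda>(i, p). p \<circ> transpose a i) x) = x"
  proof
    fix x assume "x \<in> (SIGMA i:S. deranged (\<not> e) S \<union> deranged (\<not> e) (S - {i}))"
    then obtain i p where x: "x = (i, p)" and i: "i \<in> S"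
      and p: "p \<in> deranged (\<not> e) S \<union> deranged (\<not> e) (S - {i})"
      by blast
    then have perm: "p permutes S"
      by (auto simp: deranged_def intro: permutes_subset)
    then have "p a = a" using S by (auto simp: permutes_def)
    moreover have "bij (p \<circ> transpose a i)"
      using perm by (simp add: bij_comp permutes_bij)
    ultimately have "inv (p \<circ> transpose a i) a = i"
      by (intro inv_f_eq) (simp_all add: bij_is_inj)
    then show "(\<lambda>q. (inv q a, q \<circ> transpose a (inv q a)))
        ((\<lambda>(i, p). p \<circ> transpose a i) x) = x"
      by (simp add: x comp_assoc)
  qed
  show "\<forall>q\<in>deranged e (insert a S).
      (\<lambda>(i, p). p \<circ> transpose a i) (inv q a, q \<circ> transpose a (inv q a)) = q"
    by (simp add: comp_assoc)
  show "(\<lambda>(i, p). p \<circ> transpose a i) ` (SIGMA i:S. deranged (\<not> e) S \<union> deranged (\<not> e) (S - {i}))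
      \<subseteq> deranged e (insert a S)"
  proof clarify
    fix i p
    assume i: "i \<in> S" and p: "p \<in> deranged (\<not> e) S \<union> deranged (\<not> e) (S - {i})"
    then have perm: "p permutes S"
      by (auto simp: deranged_def intro: permutes_subset)
    have "a \<noteq> i" using i S by auto
    have "p a = a" using S perm by (auto simp: permutes_def)
    have in_S: "p i \<in> S" using perm i by (simp add: permutes_in_image)
    have "p \<circ> transpose a i permutes insert a S"
      using perm i by (intro permutes_compose permutes_swap_id permutes_subset[OF perm]) auto
    moreover have "(p \<circ> transpose a i) k \<noteq> k" if "k \<in> insert a S" for k
      using that i p S in_S \<open>p a = a\<close> by (auto simp: deranged_def transpose_def)
    moreover have "evenperm (p \<circ> transpose a i) = e"
      using p evenperm_comp_transpose[OF perm \<open>finite S\<close> \<open>a \<noteq> i\<close>] by (auto simp: deranged_def)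
    ultimately show "p \<circ> transpose a i \<in> deranged e (insert a S)"
      unfolding deranged_def by blast
  qed
  show "(\<lambda>q. (inv q a, q \<circ> transpose a (inv q a))) ` deranged e (insert a S)
      \<subseteq> (SIGMA i:S. deranged (\<not> e) S \<union> deranged (\<not> e) (S - {i}))"
  proof clarify
    fix q
    assume q: "q \<in> deranged e (insert a S)"
    then have perm: "q permutes insert a S" by (simp add: deranged_def)
    define i where "i = inv q a"
    have qi: "q i = a" using permutes_inverses(1)[OF perm] by (simp add: i_def)
    have "q a \<noteq> a" using q by (simp add: deranged_def)
    then have "i \<noteq> a" using qi by auto
    have "i \<in> S"
      using perm qi \<open>i \<noteq> a\<close> by (metis insertE insertI1 permutes_in_image)
    let ?p = "q \<circ> transpose a i"
    have "?p permutes insert a S"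
      using \<open>i \<in> S\<close> by (intro permutes_compose permutes_swap_id perm) auto
    then have perm': "?p permutes S"
      by (rule permutes_superset) (auto simp: qi)
    have even: "evenperm ?p = (\<not> e)"
      using q S evenperm_comp_transpose[OF perm, of a i] \<open>i \<noteq> a\<close> by (simp add: deranged_def)
    have nofix: "?p k \<noteq> k" if "k \<in> S" "k \<noteq> i" for k
      using that q S by (auto simp: deranged_def transpose_def)
    have "?p \<in> deranged (\<not> e) S \<union> deranged (\<not> e) (S - {i})"
    \<comment> \<open>As \<open>?p i = q a\<close>, this asks whether a and i form a 2-cycle of
      \<open>q\<close>.\<close>
    proof (cases "?p i = i")
      case True
      then have "?p permutes S - {i}"
        using perm' by (intro permutes_superset[OF perm']) auto
      then show ?thesis using even nofix by (auto simp: deranged_def)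
    next
      case False
      then show ?thesis using perm' even nofix unfolding deranged_def by blast
    qed
    with \<open>i \<in> S\<close> show "inv q a \<in> S \<and> q \<circ> transpose a (inv q a)
        \<in> deranged (\<not> e) S \<union> deranged (\<not> e) (S - {inv q a})"
      by (simp add: i_def)
  qed
qed

text \<open>Since a exceeds all letters, the arc into a is an excedance and the arc out of a is not;
  all other arcs persist. Fixed points of p are allowed, so the 2-cycle case is covered as
  well.\<close>

lemma exc_set_insertion:
  assumes "p permutes S" "i \<in> S" "\<And>k. k \<in> S \<Longrightarrow> k < a"
  shows "exc_set (insert a S) (p \<circ> transpose a i) = insert i (exc_set S p)"
proof -
  have "a \<notin> S" using assms(3) by auto
  then have "p a = a" using assms(1) by (auto simp: permutes_def)
  moreover have "p i < a" using assms by (simp add: permutes_in_image)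
  moreover have "(p \<circ> transpose a i) k = p k" if "k \<in> S" "k \<noteq> i" for k
    using that \<open>a \<notin> S\<close> by (auto simp: transpose_def)
  moreover have "(p \<circ> transpose a i) a = p i" "(p \<circ> transpose a i) i = p a"
    by simp_all
  ultimately show ?thesis
    using assms(2,3) unfolding exc_set_def by (auto simp del: comp_apply split: if_splits) (metis+)
qed

text \<open>Transporting the sum along \<open>insertion_bij\<close> gives the weight
  \<open>?w i p\<close>. Derangements of S, summed over all their arcs, yield the operator; those of
  S without i yield the factor t.\<close>

lemma exc_poly_insert:
  assumes fin: "finite S" and max: "\<And>k. k \<in> S \<Longrightarrow> k < a"
  shows "exc_poly e (insert a S)
    = insertion_op (card S) (exc_poly (\<not> e) S) + (\<Sum>i\<in>S. [:0, 1:] * exc_poly (\<not> e) (S - {i}))"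
proof -
  let ?D = "deranged (\<not> e)"
  let ?w = "\<lambda>i p. monom 1 (card (insert i (exc_set S p))) :: real poly"
  have "a \<notin> S" using max by auto
  have finE: "finite (exc_set S p)" for p using fin by (simp add: exc_set_def)
  \<comment> \<open>Inserting i leaves \<open>exc_set S p\<close> unchanged or enlarges it by one,
    according to whether i already belongs to it.\<close>
  have arcs: "(\<Sum>i\<in>S. ?w i p) = insertion_op (card S) (monom 1 (card (exc_set S p)))" for p
  proof -
    let ?E = "exc_set S p"
    have sub: "?E \<subseteq> S" by (auto simp: exc_set_def)
    have "(\<Sum>i\<in>S. ?w i p) = (\<Sum>i\<in>S - ?E. ?w i p) + (\<Sum>i\<in>?E. ?w i p)"
      using sub fin by (rule sum.subset_diff)
    also have "(\<Sum>i\<in>S - ?E. ?w i p) = (\<Sum>i\<in>S - ?E. monom 1 (card ?E + 1))"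
      using finE by (intro sum.cong) auto
    also have "(\<Sum>i\<in>?E. ?w i p) = (\<Sum>i\<in>?E. monom 1 (card ?E))"
      by (intro sum.cong) (auto simp: insert_absorb)
    finally show ?thesis
      using sub fin finE
      by (simp add: insertion_op_monom card_mono card_Diff_subset of_nat_poly add.commute)
  qed
  \<comment> \<open>Here p fixes i, so i is no excedance of p and the new 2-cycle contributes
    exactly one.\<close>
  have cycles: "(\<Sum>p\<in>?D (S - {i}). ?w i p) = [:0, 1:] * exc_poly (\<not> e) (S - {i})" if "i \<in> S" for i
    unfolding exc_poly_def sum_distrib_left
  proof (rule sum.cong[OF refl])
    fix p assume "p \<in> ?D (S - {i})"
    then have "p i = i" by (auto simp: deranged_def permutes_def)
    then have "exc_set S p = exc_set (S - {i}) p" "i \<notin> exc_set S p"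
      by (auto simp: exc_set_def)
    then show "?w i p = [:0, 1:] * monom 1 (card (exc_set (S - {i}) p))"
      using finE[of p] by (simp add: monom_Suc)
  qed
  have "exc_poly e (insert a S)
      = (\<Sum>(i, p)\<in>(SIGMA i:S. ?D S \<union> ?D (S - {i})).
          monom 1 (card (exc_set (insert a S) (p \<circ> transpose a i))))"
    unfolding exc_poly_def
    by (subst sum.reindex_bij_betw[OF insertion_bij[OF fin \<open>a \<notin> S\<close>], symmetric])
       (simp add: case_prod_unfold)
  also have "\<dots> = (\<Sum>(i, p)\<in>(SIGMA i:S. ?D S \<union> ?D (S - {i})). ?w i p)"
  proof (intro sum.cong refl, clarify)
    fix i p
    assume i: "i \<in> S" and "p \<in> ?D S \<union> ?D (S - {i})"
    then have "p permutes S" by (auto simp: deranged_def intro: permutes_subset)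
    then show "monom 1 (card (exc_set (insert a S) (p \<circ> transpose a i))) = ?w i p"
      using i max by (simp add: exc_set_insertion)
  qed
  also have "\<dots> = (\<Sum>i\<in>S. \<Sum>p\<in>?D S \<union> ?D (S - {i}). ?w i p)"
    using fin by (subst sum.Sigma) (auto simp: finite_deranged)
  also have "\<dots> = (\<Sum>i\<in>S. (\<Sum>p\<in>?D S. ?w i p) + (\<Sum>p\<in>?D (S - {i}). ?w i p))"
  proof (rule sum.cong[OF refl])
    fix i assume "i \<in> S"
    then have "?D S \<inter> ?D (S - {i}) = {}"
      by (auto simp: deranged_def permutes_def)
    then show "(\<Sum>p\<in>?D S \<union> ?D (S - {i}). ?w i p)
        = (\<Sum>p\<in>?D S. ?w i p) + (\<Sum>p\<in>?D (S - {i}). ?w i p)"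
      using fin by (intro sum.union_disjoint) (auto simp: finite_deranged)
  qed
  \<comment> \<open>With p outermost, the inner sum runs over all arcs of a fixed p, as in
    \<open>arcs\<close>.\<close>
  also have "\<dots> = (\<Sum>p\<in>?D S. \<Sum>i\<in>S. ?w i p) + (\<Sum>i\<in>S. \<Sum>p\<in>?D (S - {i}). ?w i p)"
    unfolding sum.distrib by (subst sum.swap) (rule refl)
  also have "(\<Sum>p\<in>?D S. \<Sum>i\<in>S. ?w i p) = insertion_op (card S) (exc_poly (\<not> e) S)"
    by (simp add: exc_poly_def arcs insertion_op_sum)
  finally show ?thesis
    by (simp only: cycles cong: sum.cong)
qed

section \<open>Induction on the number of letters\<close>

text \<open>Strong induction, as the recursion reaches back to sets with one and two letters fewer;
  \<open>e\<close> stays arbitrary because the parity flips.\<close>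

lemma gamma_cone_exc_poly:
  assumes "finite S"
  shows "gamma_cone (card S) (exc_poly e S)"
  using assms
proof (induction "card S" arbitrary: S e rule: less_induct)
  case less
  show ?case
  proof (cases "S = {}")
    case True
    \<comment> \<open>The empty permutation is even, so the polynomial is 1 or 0 according to
      parity.\<close>
    have "deranged e {} = (if e then {id} else {})"
      by (auto simp: deranged_def evenperm_id)
    then have "exc_poly e S = smult (if e then 1 else 0) ([:0, 1:] ^ 0 * [:1, 1:] ^ (0 - 2 * 0))"
      using True by (simp add: exc_poly_def exc_set_def)
    then show ?thesis
      using True gamma_cone_basis[of "if e then 1 else 0" 0 0] by simp
  next
    case False
    define a T where "a = Max S" and "T = S - {a}"
    have S: "S = insert a T" "a \<notin> T" and finT: "finite T"
      using False less.prems Max_in by (auto simp: a_def T_def)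
    have max: "k < a" if "k \<in> T" for k
      using that less.prems Max_ge[of S k] by (simp add: a_def T_def order_less_le)
    have card: "card S = card T + 1" using S finT by simp
    have "gamma_cone (card S) (insertion_op (card T) (exc_poly (\<not> e) T))"
      unfolding card using card finT by (intro gamma_cone_insertion_op less.hyps) auto
    moreover have "gamma_cone (card S) ([:0, 1:] * exc_poly (\<not> e) (T - {i}))" if "i \<in> T" for i
    proof -
      \<comment> \<open>Losing two letters lowers the center by one, which the factor t
        restores.\<close>
      have *: "card S = card (T - {i}) + 2"
        using that finT card card_Suc_Diff1[OF finT that] by simp
      then show ?thesis
        unfolding * by (intro gamma_cone_times_X less.hyps) (simp_all add: * finT)
    qed
    ultimately show ?thesis
      using exc_poly_insert[OF finT max, of e] S(1) by (simp add: gamma_cone_add gamma_cone_sum)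
  qed
qed

theorem theorem42:
  fixes n :: nat
  assumes "n \<ge> 1"
  shows "gamma_positive (ADerExc n) (real n / 2)
    \<and> gamma_positive (ADerExc_plus n) (real n / 2)
    \<and> gamma_positive (ADerExc_minus n) (real n / 2)"
proof -
  let ?S = "{1..n}"
  have even: "even_derangements n = deranged True ?S"
    and odd: "odd_derangements n = deranged False ?S"
    by (auto simp: even_derangements_def odd_derangements_def derangements_def alt_perms_def
        sym_perms_def deranged_def)
  have exc: "exc n p = card (exc_set ?S p)" for p
    by (simp add: exc_def exc_set_def)
  have plus: "ADerExc_plus n = exc_poly True ?S" and minus: "ADerExc_minus n = exc_poly False ?S"
    by (simp_all add: ADerExc_plus_def ADerExc_minus_def exc_poly_def even odd exc)
  have "derangements n = even_derangements n \<union> odd_derangements n"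
    "even_derangements n \<inter> odd_derangements n = {}"
    by (auto simp: even_derangements_def odd_derangements_def)
  then have total: "ADerExc n = ADerExc_plus n + ADerExc_minus n"
    unfolding ADerExc_def ADerExc_plus_def ADerExc_minus_def
    by (simp add: sum.union_disjoint even odd finite_deranged)
  \<comment> \<open>Both parities lie in the same cone, so their sum does too.\<close>
  have "gamma_cone n (exc_poly e ?S)" for e
    using gamma_cone_exc_poly[of ?S e] by simp
  then show ?thesis
    unfolding total plus minus by (intro conjI gamma_cone_imp_gamma_positive gamma_cone_add)
qed

end
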